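(* For an integer $m\ge 0$ and $x\in(-2,2)$ let $$\omega(m,x)=x^m\left(\psi^{(0)}(x+2)+x\,\psi^{(1)}(x+2)+\psi^{(0)}(2-x)-x\,\psi^{(1)}(2-x)\right).$$ Then for every integer $m\geq 0$, $$\sum_{k=1}^{\infty}(2k+1)(\zeta(2k+1)-1)F_{2k+m}=(1-\gamma)F_m-\frac{1}{2\sqrt5}\left(\omega(m,\alpha)-\omega(m,\beta)\right)$$ and $$\sum_{k=1}^{\infty}(2k+1)(\zeta(2k+1)-1)L_{2k+m}=(1-\gamma)L_m-\frac12\left(\omega(m,\alpha)+\omega(m,\beta)\right).$$
   Context: $\zeta$ denotes the Riemann zeta function, and $\gamma$ the Euler-Mascheroni constant. $\psi^{(0)}(z)=\Gamma'(z)/\Gamma(z)$ is the digamma function and $\psi^{(1)}=\frac{d}{dz}\psi^{(0)}$ is its derivative (the trigamma function). $\alpha=\frac{1+\sqrt5}{2}$ and $\beta=\frac{1-\sqrt5}{2}$. $F_n$ and $L_n$ denote the Fibonacci and Lucas numbers: both satisfy $x_n=x_{n-1}+x_{n-2}$ for $n\ge 2$, with $F_0=0$, $F_1=1$ and $L_0=2$, $L_1=1$. *)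

theory Defs
  imports "HOL-Analysis.Analysis" "HOL-Number_Theory.Fib"
begin

text \<open>
  The Riemann zeta function on the half-line \<open>s > 1\<close>, where it is given by its Dirichlet
  series; only its values at the integers \<open>3, 5, 7, \<dots>\<close> are used. For \<open>s \<le> 1\<close> the series
  diverges and the value is meaningless.
\<close>
definition riemann_zeta :: "real \<Rightarrow> real" where
  "riemann_zeta s = (\<Sum>n. 1 / real (Suc n) powr s)"

fun lucas :: "nat \<Rightarrow> nat" where
  "lucas 0 = 2"
| "lucas (Suc 0) = 1"
| "lucas (Suc (Suc n)) = lucas (Suc n) + lucas n"

definition alpha :: real where
  "alpha = (1 + sqrt 5) / 2"

definition beta :: real where
  "beta = (1 - sqrt 5) / 2"

text \<open>
  The library defines the polygamma functions by series. The next two lemmas confirm that on the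
  positive reals they are the logarithmic derivative of the Gamma function and the derivative
  of the latter.
\<close>
lemma Digamma_eq_deriv_Gamma:
  fixes x :: real
  assumes "x > 0"
  shows "Digamma x = deriv Gamma x / Gamma x"
proof -
  have "x \<notin> \<int>\<^sub>\<le>\<^sub>0"
    using assms by (auto elim!: nonpos_Ints_cases)
  then have "(Gamma has_field_derivative Gamma x * Digamma x) (at x)"
    by (rule has_field_derivative_Gamma)
  then have "deriv Gamma x = Gamma x * Digamma x"
    by (rule DERIV_imp_deriv)
  moreover have "Gamma x \<noteq> 0"
    using assms by (simp add: Gamma_real_pos less_imp_neq[symmetric])
  ultimately show ?thesis
    by simp
qed

lemma Polygamma_1_eq_deriv_Digamma:
  fixes x :: real
  assumes "x > 0"
  shows "Polygamma 1 x = deriv Digamma x"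
proof -
  have "x \<notin> \<int>\<^sub>\<le>\<^sub>0"
    using assms by (auto elim!: nonpos_Ints_cases)
  then have "(Digamma has_field_derivative Polygamma (Suc 0) x) (at x)"
    by (rule has_field_derivative_Polygamma)
  then show ?thesis
    by (simp add: DERIV_imp_deriv)
qed

text \<open>Only meant for \<open>-2 < x < 2\<close>, so that \<open>x + 2\<close> and \<open>2 - x\<close> are both positive.\<close>
definition omega :: "nat \<Rightarrow> real \<Rightarrow> real" where
  "omega m x = x ^ m * (Digamma (x + 2) + x * Polygamma 1 (x + 2)
                        + Digamma (2 - x) - x * Polygamma 1 (2 - x))"

end

theory Submission
  imports Defs
begin

text \<open>
  By Binet's formulas both series are linear combinations of the power series
  \<open>\<Sum>\<^sub>k (2k+1) (\<zeta>(2k+1) - 1) x\<^bsup>2k\<^esup>\<close> at \<open>x = \<alpha>\<close> and \<open>x = \<beta>\<close>, both of which lie in \<open>(-2, 2)\<close>; so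
  everything rests on the closed form of that power series, \<open>sums_odd_zeta_tail\<close>.

  To find it, expand \<open>\<zeta>(2k+1) - 1\<close> as the sum of \<open>n\<^bsup>-(2k+1)\<^esup>\<close> over \<open>n \<ge> 2\<close> and sum over \<open>k\<close> before
  \<open>n\<close>. All terms are nonnegative because only even powers of \<open>x\<close> occur, so the interchange needs
  only that one of the two iterated sums converges. For fixed \<open>n\<close> the sum over \<open>k\<close> is the
  derivative of \<open>\<Sum>\<^sub>k (x/n)\<^bsup>2k+1\<^esup>\<close>, up to the term \<open>k = 0\<close>, hence a rational function of \<open>x\<close>
  (\<open>sums_odd_geometric_tail\<close>). Its partial fractions have the poles \<open>\<plusminus>n\<close>, simple and double:
  summed over \<open>n \<ge> 2\<close>, the simple ones give the series of the digamma function at \<open>2 \<plusminus> x\<close>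
  and the double ones that of the trigamma function.
\<close>

lemma sums_odd_geometric_tail:
  fixes x a :: real
  assumes "\<bar>x\<bar> < a"
  shows "(\<lambda>k. real (2 * k + 3) * x ^ (2 * k + 2) / a ^ (2 * k + 3)) sums
    (((1 / (a - x) - 1 / a) + (1 / (a + x) - 1 / a) + x / (a - x)\<^sup>2 - x / (a + x)\<^sup>2) / 2)"
proof -
  define q where "q = (x / a)\<^sup>2"
  have a: "a > 0" "a - x > 0" "a + x > 0"
    using assms by auto
  have "\<bar>x / a\<bar> < 1"
    using assms a by simp
  then have q: "\<bar>q\<bar> < 1"
    unfolding q_def by (simp add: abs_square_less_1)
  \<comment> \<open>Writing \<open>2k + 3 = 2 (k + 1) + 1\<close> leaves the geometric series in \<open>q\<close> and its derivative.\<close>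
  have "(\<lambda>k. q / a * (2 * (of_nat (Suc k) * q ^ k) + q ^ k)) sums
      (q / a * (2 * (1 / (1 - q)\<^sup>2) + 1 / (1 - q)))"
    using q by (intro sums_mult sums_add geometric_deriv_sums geometric_sums) auto
  moreover have "q / a * (2 * (of_nat (Suc k) * q ^ k) + q ^ k) =
      real (2 * k + 3) * x ^ (2 * k + 2) / a ^ (2 * k + 3)" for k
  proof -
    have "q ^ Suc k = x ^ (2 * k + 2) / a ^ (2 * k + 2)"
      by (simp add: q_def power_mult [symmetric] power_divide del: power_Suc)
    moreover have "q / a * (2 * (of_nat (Suc k) * q ^ k) + q ^ k) = real (2 * k + 3) * q ^ Suc k / a"
      by (simp add: algebra_simps add_divide_distrib)
    ultimately show ?thesis
      by (simp add: eval_nat_numeral)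
  qed
  moreover have "q / a * (2 * (1 / (1 - q)\<^sup>2) + 1 / (1 - q)) =
      ((1 / (a - x) - 1 / a) + (1 / (a + x) - 1 / a) + x / (a - x)\<^sup>2 - x / (a + x)\<^sup>2) / 2"
  proof -
    have *: "1 - q = (a - x) * (a + x) / a\<^sup>2" "q = x\<^sup>2 / a\<^sup>2"
      using a by (simp_all add: q_def power_divide field_simps power2_eq_square)
    show ?thesis
      unfolding *(1) unfolding *(2) using a 
      by (simp add: divide_simps) algebra
  qed
  ultimately show ?thesis
    by (simp only:)
qed

text \<open>
  Taking the difference with the series at \<open>2\<close>, where \<open>\<psi>(2) = 1 - \<gamma>\<close>, replaces the comparison
  terms \<open>1 / (n + 1)\<close> in the series of the digamma function by the required \<open>1 / (n + 2)\<close>.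
\<close>
lemma sums_Digamma_from_two:
  fixes z :: real
  assumes "z \<noteq> 0"
  shows "(\<lambda>n. 1 / (z + real n) - 1 / real (n + 2)) sums (1 - euler_mascheroni - Digamma z)"
proof -
  have *: "(\<lambda>n. inverse (real (Suc n)) - inverse (y + real n)) sums (Digamma y + euler_mascheroni)"
    if "y \<noteq> 0" for y :: real
    using summable_sums[OF summable_Digamma[OF that]] by (simp add: Digamma_def)
  have "Digamma (2 :: real) = 1 - euler_mascheroni"
    by (simp add: Digamma_numeral harm_expand)
  then have "(Digamma 2 + euler_mascheroni) - (Digamma z + euler_mascheroni) =
      1 - euler_mascheroni - Digamma z"
    by simp
  moreover have "(inverse (real (Suc n)) - inverse (2 + real n)) -
      (inverse (real (Suc n)) - inverse (z + real n)) = 1 / (z + real n) - 1 / real (n + 2)" for n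
    by (simp add: inverse_eq_divide add.commute)
  ultimately show ?thesis
    using sums_diff[OF *[of 2] *[OF assms]] by (simp only:)
qed

lemma sums_trigamma:
  fixes z :: real
  assumes "z \<noteq> 0"
  shows "(\<lambda>n. 1 / (z + real n)\<^sup>2) sums Polygamma 1 z"
  using Polygamma_LIMSEQ[OF assms, of 1] by (simp add: power2_eq_square inverse_eq_divide)

lemma riemann_zeta_minus_one_sums:
  assumes "s > 1"
  shows "(\<lambda>n. 1 / real (n + 2) ^ s) sums (riemann_zeta (real s) - 1)"
proof -
  have "summable (\<lambda>n. inverse (real n ^ s))"
    using assms by (intro inverse_power_summable) auto
  then have "summable (\<lambda>n. 1 / real (Suc n) ^ s)"
    by (subst (asm) summable_Suc_iff [symmetric]) (simp add: inverse_eq_divide)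
  then have "(\<lambda>n. 1 / real (Suc n) ^ s) sums riemann_zeta (real s)"
    by (simp add: riemann_zeta_def powr_realpow summable_sums del: of_nat_Suc)
  then have "(\<lambda>n. 1 / real (Suc (Suc n)) ^ s) sums (riemann_zeta (real s) - 1)"
    by (subst sums_Suc_iff) simp
  then show ?thesis
    by (simp add: add.commute)
qed

text \<open>
  Tonelli's theorem for double series: nonnegativity turns the iterated convergence into
  unconditional summability over all pairs of indices, where the order does not matter.
\<close>
lemma sums_swap_nonneg:
  fixes f :: "nat \<Rightarrow> nat \<Rightarrow> real"
  assumes nonneg: "\<And>n k. f n k \<ge> 0"
    and rows: "\<And>n. f n sums g n"
    and total: "g sums S"
    and columns: "\<And>k. (\<lambda>n. f n k) sums h k"
  shows "h sums S"
proof -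
  have rows': "(f n has_sum g n) UNIV" for n
    using rows nonneg by (intro sums_nonneg_imp_has_sum) auto
  have "g n \<ge> 0" for n
    using nonneg by (intro has_sum_nonneg[OF rows'])
  then have total': "(g has_sum S) UNIV"
    using total by (intro sums_nonneg_imp_has_sum) auto
  have "(\<lambda>(n, k). f n k) summable_on UNIV \<times> UNIV"
    using rows' total' nonneg
    by (intro summable_on_SigmaI[where g = g]) (auto simp: summable_on_def)
  then have "((\<lambda>(n, k). f n k) has_sum S) (UNIV \<times> UNIV)"
    using rows' total' by (intro has_sum_SigmaI[where g = g]) auto
  then have *: "((\<lambda>(k, n). f n k) has_sum S) (UNIV \<times> UNIV)"
    by (subst (asm) has_sum_swap) simp
  have "((\<lambda>n. f n k) has_sum h k) UNIV" for k
    using columns nonneg by (intro sums_nonneg_imp_has_sum) auto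
  then have "(h has_sum S) UNIV"
    by (intro has_sum_SigmaD[OF *]) simp
  then show ?thesis
    by (rule has_sum_imp_sums)
qed

lemma sums_odd_zeta_tail:
  fixes x :: real
  assumes "\<bar>x\<bar> < 2"
  shows "(\<lambda>k. real (2 * k + 3) * (riemann_zeta (real (2 * k + 3)) - 1) * x ^ (2 * k + 2)) sums
    (1 - euler_mascheroni - omega 0 x / 2)"
proof (rule sums_swap_nonneg)
  let ?f = "\<lambda>n k. real (2 * k + 3) * x ^ (2 * k + 2) / real (n + 2) ^ (2 * k + 3)"
  let ?g = "\<lambda>n. ((1 / (2 - x + real n) - 1 / real (n + 2)) + (1 / (x + 2 + real n) - 1 / real (n + 2))
    + x * (1 / (2 - x + real n)\<^sup>2) - x * (1 / (x + 2 + real n)\<^sup>2)) / 2"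
  show "?f n k \<ge> 0" for n k
  proof -
    have "x ^ (2 * k + 2) \<ge> 0"
      by (rule zero_le_even_power) simp
    then show ?thesis
      by (simp only: divide_nonneg_nonneg mult_nonneg_nonneg zero_le_power of_nat_0_le_iff)
  qed
  show "?f n sums ?g n" for n
    using sums_odd_geometric_tail[of x "real (n + 2)"] assms by (simp add: algebra_simps)
  have "2 - x \<noteq> 0" "x + 2 \<noteq> 0"
    using assms by auto
  then have "?g sums (((1 - euler_mascheroni - Digamma (2 - x))
      + (1 - euler_mascheroni - Digamma (x + 2))
      + x * Polygamma 1 (2 - x) - x * Polygamma 1 (x + 2)) / 2)"
    by (intro sums_divide sums_add sums_diff sums_mult sums_Digamma_from_two sums_trigamma)
  then show "?g sums (1 - euler_mascheroni - omega 0 x / 2)"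
    by (simp add: omega_def field_simps)
  show "(\<lambda>n. ?f n k) sums
      (real (2 * k + 3) * (riemann_zeta (real (2 * k + 3)) - 1) * x ^ (2 * k + 2))" for k
    using sums_mult[OF riemann_zeta_minus_one_sums[of "2 * k + 3"],
        of "real (2 * k + 3) * x ^ (2 * k + 2)"]
    by (simp add: mult_ac)
qed

lemma fib_Binet: "real (fib n) = (alpha ^ n - beta ^ n) / sqrt 5"
  unfolding alpha_def beta_def by (rule fib_closed_form)

lemma lucas_Binet: "real (lucas n) = alpha ^ n + beta ^ n"
proof (induction n rule: lucas.induct)
  case (3 n)
  have "alpha ^ 2 = alpha + 1" "beta ^ 2 = beta + 1"
    by (simp_all add: alpha_def beta_def power2_eq_square field_simps)
  then have "alpha ^ Suc (Suc n) = alpha ^ Suc n + alpha ^ n"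
    "beta ^ Suc (Suc n) = beta ^ Suc n + beta ^ n"
    by (simp_all add: power2_eq_square flip: mult.assoc) (simp_all add: algebra_simps)
  with 3 show ?case
    by simp
qed (simp_all add: alpha_def beta_def field_simps)

lemma abs_alpha_less_2: "\<bar>alpha\<bar> < 2" and abs_beta_less_2: "\<bar>beta\<bar> < 2"
proof -
  have "sqrt 5 < 3" "sqrt 5 > 0"
    by (auto intro: real_less_lsqrt)
  then show "\<bar>alpha\<bar> < 2" "\<bar>beta\<bar> < 2"
    by (auto simp: alpha_def beta_def)
qed

theorem theorem2p0p3:
  fixes m :: nat
  shows "((\<lambda>j. let k = j + 1 in
            real (2 * k + 1) * (riemann_zeta (real (2 * k + 1)) - 1) * real (fib (2 * k + m)))
          sums ((1 - euler_mascheroni) * real (fib m)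
                - 1 / (2 * sqrt 5) * (omega m alpha - omega m beta)))
       \<and> ((\<lambda>j. let k = j + 1 in
            real (2 * k + 1) * (riemann_zeta (real (2 * k + 1)) - 1) * real (lucas (2 * k + m)))
          sums ((1 - euler_mascheroni) * real (lucas m)
                - 1 / 2 * (omega m alpha + omega m beta)))"
proof -
  define c where "c j = real (2 * j + 3) * (riemann_zeta (real (2 * j + 3)) - 1)" for j :: nat
  have shifted: "(\<lambda>j. c j * x ^ (2 * j + 2 + m)) sums
      ((1 - euler_mascheroni) * x ^ m - omega m x / 2)" if "\<bar>x\<bar> < 2" for x
    using sums_mult[OF sums_odd_zeta_tail[OF that], of "x ^ m"]
    by (simp add: c_def omega_def power_add algebra_simps)
  note A = shifted[OF abs_alpha_less_2] and B = shifted[OF abs_beta_less_2]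
  have fib: "(\<lambda>j. c j * real (fib (2 * j + 2 + m))) sums
      ((1 - euler_mascheroni) * real (fib m) - 1 / (2 * sqrt 5) * (omega m alpha - omega m beta))"
  proof -
    have "(c j * alpha ^ n - c j * beta ^ n) / sqrt 5 = c j * real (fib n)" for j n
      by (simp only: fib_Binet right_diff_distrib [symmetric] times_divide_eq_right)
    moreover have "((p * a - u / 2) - (p * b - v / 2)) / s =
        p * ((a - b) / s) - 1 / (2 * s) * (u - v)" for p a b u v s :: real
      by (cases "s = 0") (simp_all add: field_simps)
    ultimately show ?thesis
      using sums_divide[OF sums_diff[OF A B], of "sqrt 5"] by (simp only: fib_Binet)
  qed
  have lucas: "(\<lambda>j. c j * real (lucas (2 * j + 2 + m))) sums
      ((1 - euler_mascheroni) * real (lucas m) - 1 / 2 * (omega m alpha + omega m beta))"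
  proof -
    have "(p * a - u / 2) + (p * b - v / 2) = p * (a + b) - 1 / 2 * (u + v)" for p a b u v :: real
      by (simp add: field_simps)
    then show ?thesis
      using sums_add[OF A B] by (simp only: lucas_Binet distrib_left [of "c _"])
  qed
  have index: "2 * (j + 1) + 1 = 2 * j + 3" "2 * (j + 1) + m = 2 * j + 2 + m" for j :: nat
    by simp_all
  show ?thesis
    unfolding Let_def index using fib lucas unfolding c_def by (rule conjI)
qed

end
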